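(* Let $\langle S,A,R,T,\gamma\rangle$ be a Markov decision process with finite state space $S$, finite action space $A$, reward function $R:S\times A\to[0,1]$, transition probabilities $T$ and discount $\gamma\in[0,1)$. Let $Q^{*}$ be its optimal action-value function, and let $Q^{\pi}$ and $Q^{\pi'}$ be the action-value functions of policies $\pi$ and $\pi'$. Given $$Q^{*}(s_t,a_t)-Q^{\pi}(s_t,a_t)<\epsilon' \quad\text{at probability } (1-\delta)$$ and $$|Q^{\pi}(s_t,a_t)-Q^{\pi'}(s_t,a_t)|\le\epsilon$$ for all $s_t\in S$ and $a_t\in A$, then $$Q^{*}(s_t,a_t)-Q^{\pi'}(s_t,a_t)\le\epsilon+\epsilon' \quad\text{at probability } (1-\delta).$$ That is, $\pi'$ is an $(\epsilon+\epsilon')$-optimal policy at probability $(1-\delta)$.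
   Context: A policy maps states to actions. For a policy $\mu$, $V^{\mu}$ and $Q^{\mu}$ denote its state-value and action-value functions; $V^{*}$ and $Q^{*}$ denote the optimal ones. The optimal policy $\pi^{*}$ is the greedy policy extracted from $V^{*}$, while $\pi$ and $\pi'$ are the policies extracted from $V^{\pi}$ and $V^{\pi'}$; $\pi$ is not assumed to be optimal. Definition. $\epsilon$-optimal policies are those within an $\epsilon$ neighborhood of $V^{*}$, specifically $V^{*}-V^{\pi}<\epsilon$ for all $a\in A$ and $s\in S$ at probability $(1-\delta)$. Setting in which the result is used. Constrained Randomization of Policy (CRoP) replaces a target policy $\pi$ by a randomized policy $f$. Fix a threshold $\rho$ and, for each state $s$, let $\hat A$ be the set of actions $\hat a\ne\pi(s)$ with $Q(s,\pi(s))-Q(s,\hat a)<\rho$. Then $f(s)=\pi(s)$ with probability $\delta$ or if $\hat A$ is empty, and with probability $1-\delta$ the action $f(s)$ is drawn uniformly from $\hat A$. The symbol $\delta$ is also the one appearing in "at probability $(1-\delta)$"; the source attaches this phrase to the inequalities without specifying the underlying probability space further. The result is presented as establishing that the CRoP policy is at worst $(\epsilon+\epsilon')$-optimal to $Q^{*}$ at probability $(1-\delta)$. *)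

theory Defs
  imports "HOL-Probability.Probability"
begin

text \<open>
  A finite Markov decision process is given by finite types of states and actions, a reward
  function \<open>R\<close>, a transition kernel \<open>T\<close> and a discount \<open>\<gamma>\<close>. Policies are stationary and possibly
  randomized; the deterministic policy \<open>s \<mapsto> d s\<close> is \<open>\<lambda>s. return_pmf (d s)\<close>.
\<close>

type_synonym ('s, 'a) policy = "'s \<Rightarrow> 'a pmf"

text \<open>The law of \<open>(s\<^sub>t, a\<^sub>t)\<close> under the policy \<open>\<mu>\<close>, when \<open>(s\<^sub>0, a\<^sub>0)\<close> has law \<open>D\<close>.\<close>

primrec sa_law ::
  "('s \<Rightarrow> 'a \<Rightarrow> 's pmf) \<Rightarrow> ('s, 'a) policy \<Rightarrow> ('s \<times> 'a) pmf \<Rightarrow> nat \<Rightarrow> ('s \<times> 'a) pmf"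
where
  "sa_law T \<mu> D 0 = D"
| "sa_law T \<mu> D (Suc t) =
     bind_pmf (sa_law T \<mu> D t)
       (\<lambda>(s, a). bind_pmf (T s a) (\<lambda>s'. map_pmf (Pair s') (\<mu> s')))"

definition discounted_return ::
  "('s \<Rightarrow> 'a \<Rightarrow> real) \<Rightarrow> ('s \<Rightarrow> 'a \<Rightarrow> 's pmf) \<Rightarrow> real \<Rightarrow> ('s, 'a) policy
    \<Rightarrow> ('s \<times> 'a) pmf \<Rightarrow> real"
where
  "discounted_return R T \<gamma> \<mu> D =
     (\<Sum>t. \<gamma> ^ t * measure_pmf.expectation (sa_law T \<mu> D t) (\<lambda>(s, a). R s a))"

definition state_value ::
  "('s \<Rightarrow> 'a \<Rightarrow> real) \<Rightarrow> ('s \<Rightarrow> 'a \<Rightarrow> 's pmf) \<Rightarrow> real \<Rightarrow> ('s, 'a) policy \<Rightarrow> 's \<Rightarrow> real"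
where
  "state_value R T \<gamma> \<mu> s = discounted_return R T \<gamma> \<mu> (map_pmf (Pair s) (\<mu> s))"

definition action_value ::
  "('s \<Rightarrow> 'a \<Rightarrow> real) \<Rightarrow> ('s \<Rightarrow> 'a \<Rightarrow> 's pmf) \<Rightarrow> real \<Rightarrow> ('s, 'a) policy \<Rightarrow> 's \<Rightarrow> 'a \<Rightarrow> real"
where
  "action_value R T \<gamma> \<mu> s a = discounted_return R T \<gamma> \<mu> (return_pmf (s, a))"

text \<open>
  The suprema are over sets of reals; they are bounded when \<open>R\<close> takes values in \<open>[0, 1]\<close> and
  \<open>0 \<le> \<gamma> < 1\<close>.
\<close>

definition opt_state_value ::
  "('s \<Rightarrow> 'a \<Rightarrow> real) \<Rightarrow> ('s \<Rightarrow> 'a \<Rightarrow> 's pmf) \<Rightarrow> real \<Rightarrow> 's \<Rightarrow> real"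
where
  "opt_state_value R T \<gamma> s = (SUP \<mu>. state_value R T \<gamma> \<mu> s)"

definition opt_action_value ::
  "('s \<Rightarrow> 'a \<Rightarrow> real) \<Rightarrow> ('s \<Rightarrow> 'a \<Rightarrow> 's pmf) \<Rightarrow> real \<Rightarrow> 's \<Rightarrow> 'a \<Rightarrow> real"
where
  "opt_action_value R T \<gamma> s a = (SUP \<mu>. action_value R T \<gamma> \<mu> s a)"

text \<open>\<open>\<mu>\<close> is a greedy policy extracted from the state-value function \<open>U\<close>.\<close>

definition greedy_policy ::
  "('s \<Rightarrow> 'a \<Rightarrow> real) \<Rightarrow> ('s \<Rightarrow> 'a \<Rightarrow> 's pmf) \<Rightarrow> real \<Rightarrow> ('s \<Rightarrow> real) \<Rightarrow> ('s, 'a) policy \<Rightarrow> bool"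
where
  "greedy_policy R T \<gamma> U \<mu> \<longleftrightarrow>
     (\<forall>s. \<forall>a\<in>set_pmf (\<mu> s). \<forall>b.
        R s b + \<gamma> * measure_pmf.expectation (T s b) U
          \<le> R s a + \<gamma> * measure_pmf.expectation (T s a) U)"

text \<open>
  A statement about a policy holding ``at probability \<open>p\<close>'' is read in the PAC sense: the policy is
  a random variable on a probability space \<open>M\<close> (a learned or a randomized policy), and the
  statement holds with probability at least \<open>p\<close>.
\<close>

definition random_policy :: "'w measure \<Rightarrow> ('w \<Rightarrow> ('s, 'a) policy) \<Rightarrow> bool" where
  "random_policy M \<pi> \<longleftrightarrow> (\<forall>s a. (\<lambda>\<omega>. pmf (\<pi> \<omega> s) a) \<in> borel_measurable M)"

definition at_prob :: "'w measure \<Rightarrow> real \<Rightarrow> ('w \<Rightarrow> bool) \<Rightarrow> bool" where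
  "at_prob M p P \<longleftrightarrow> measure M {\<omega> \<in> space M. P \<omega>} \<ge> p"

definition eps_optimal_V ::
  "('s \<Rightarrow> 'a \<Rightarrow> real) \<Rightarrow> ('s \<Rightarrow> 'a \<Rightarrow> 's pmf) \<Rightarrow> real \<Rightarrow> 'w measure \<Rightarrow> real \<Rightarrow> real
    \<Rightarrow> ('w \<Rightarrow> ('s, 'a) policy) \<Rightarrow> bool"
where
  "eps_optimal_V R T \<gamma> M \<delta> e \<pi> \<longleftrightarrow>
     at_prob M (1 - \<delta>) (\<lambda>\<omega>. \<forall>s. opt_state_value R T \<gamma> s - state_value R T \<gamma> (\<pi> \<omega>) s < e)"

text \<open>
  Closeness of action values does not bound the loss in state values of an arbitrary policy: if
  \<open>\<gamma> = 0\<close>, all policies have the same action values. Hence \<open>\<epsilon>\<close>-optimality relative to the optimal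
  action values is a notion of its own.
\<close>

definition eps_optimal_Q ::
  "('s \<Rightarrow> 'a \<Rightarrow> real) \<Rightarrow> ('s \<Rightarrow> 'a \<Rightarrow> 's pmf) \<Rightarrow> real \<Rightarrow> 'w measure \<Rightarrow> real \<Rightarrow> real
    \<Rightarrow> ('w \<Rightarrow> ('s, 'a) policy) \<Rightarrow> bool"
where
  "eps_optimal_Q R T \<gamma> M \<delta> e \<pi> \<longleftrightarrow>
     at_prob M (1 - \<delta>)
       (\<lambda>\<omega>. \<forall>s a. opt_action_value R T \<gamma> s a - action_value R T \<gamma> (\<pi> \<omega>) s a < e)"

end

theory Submission imports Defs begin

text \<open>
  The action-value inequalities are pointwise in the policy, and they transfer to
  probabilities because \<open>Q\<^sup>\<mu>\<close> is a measurable function of \<open>\<mu>\<close>. For the state values, write \<open>V\<^sup>\<mu>(s)\<close> as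
  the \<open>\<mu>(s)\<close>-average of \<open>Q\<^sup>\<mu>(s, \<cdot>)\<close>. Then \<open>V\<^sup>*(s) \<le> max\<^sub>a Q\<^sup>*(s, a)\<close>, and a policy that is greedy for its
  own state values satisfies \<open>V\<^sup>\<mu>(s) \<ge> max\<^sub>a Q\<^sup>\<mu>(s, a)\<close>. So the loss in state values is at most the
  largest loss in action values.
\<close>

lemma expectation_pmf_finite:
  fixes f :: "'x::finite \<Rightarrow> real"
  shows "measure_pmf.expectation D f = (\<Sum>x\<in>UNIV. pmf D x * f x)"
  using integral_measure_pmf_real[of UNIV D f] by (simp add: mult.commute)

lemma expectation_bind_pmf_finite:
  fixes g :: "'y::finite \<Rightarrow> real" and D :: "'x::finite pmf"
  shows "measure_pmf.expectation (bind_pmf D f) g =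
    measure_pmf.expectation D (\<lambda>x. measure_pmf.expectation (f x) g)"
proof -
  have "measure_pmf.expectation (bind_pmf D f) g = (\<Sum>y\<in>UNIV. \<Sum>x\<in>UNIV. pmf D x * (pmf (f x) y * g y))"
    by (simp add: expectation_pmf_finite pmf_bind sum_distrib_right mult.assoc)
  also have "\<dots> = (\<Sum>x\<in>UNIV. \<Sum>y\<in>UNIV. pmf D x * (pmf (f x) y * g y))"
    by (rule sum.swap)
  finally show ?thesis
    by (simp add: expectation_pmf_finite sum_distrib_left)
qed

lemma expectation_pmf_le_finite:
  fixes f :: "'x::finite \<Rightarrow> real"
  assumes "\<And>x. x \<in> set_pmf D \<Longrightarrow> f x \<le> c"
  shows "measure_pmf.expectation D f \<le> c"
  by (intro measure_pmf.integral_le_const integrable_measure_pmf_finite)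
     (auto simp: AE_measure_pmf_iff assms)

lemma expectation_pmf_ge_finite:
  fixes f :: "'x::finite \<Rightarrow> real"
  assumes "\<And>x. x \<in> set_pmf D \<Longrightarrow> c \<le> f x"
  shows "c \<le> measure_pmf.expectation D f"
  by (intro measure_pmf.integral_ge_const integrable_measure_pmf_finite)
     (auto simp: AE_measure_pmf_iff assms)

lemma sa_law_bind:
  "sa_law T \<mu> (bind_pmf D f) t = bind_pmf D (\<lambda>x. sa_law T \<mu> (f x) t)"
  by (induction t) (simp_all add: bind_assoc_pmf)

text \<open>The recursion appends each step at the end of the trajectory; the Bellman equation needs
  the first step absorbed into the initial law instead.\<close>

lemma sa_law_Suc_shift:
  "sa_law T \<mu> D (Suc t) =
    sa_law T \<mu> (bind_pmf D (\<lambda>(s, a). bind_pmf (T s a) (\<lambda>s'. map_pmf (Pair s') (\<mu> s')))) t"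
  by (induction t) simp_all

text \<open>On finite types each weight of \<open>sa_law\<close> at time t is a polynomial in the
  weights of the random policy and of the initial law, hence measurable, and the return is a series
  of such terms.\<close>

lemma discounted_return_measurable:
  fixes T :: "'s::finite \<Rightarrow> 'a::finite \<Rightarrow> 's pmf"
  assumes \<mu>: "random_policy M \<mu>"
    and D: "\<And>x. (\<lambda>\<omega>. pmf (D \<omega>) x) \<in> borel_measurable M"
  shows "(\<lambda>\<omega>. discounted_return R T \<gamma> (\<mu> \<omega>) (D \<omega>)) \<in> borel_measurable M"
proof -
  \<comment> \<open>This reduces the weights of the pushed-forward action law to the policy weights,
    whose measurability is assumed.\<close>
  have pair: "pmf (map_pmf (Pair s') p) (s, a) = (if s' = s then pmf p a else 0)"
    for s s' :: 's and a :: 'a and p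
  proof (cases "s' = s")
    case True
    have "inj (Pair s')" by (simp add: inj_on_def)
    from pmf_map_inj'[OF this, of p a] True show ?thesis by simp
  next
    case False
    then show ?thesis by (auto simp: pmf_eq_0_set_pmf)
  qed
  have [measurable]: "(\<lambda>\<omega>. pmf (\<mu> \<omega> s) a) \<in> borel_measurable M" for s a
    using \<mu> by (simp add: random_policy_def)
  have law [measurable]: "(\<lambda>\<omega>. pmf (sa_law T (\<mu> \<omega>) (D \<omega>) t) x) \<in> borel_measurable M" for t x
  proof (induction t arbitrary: x)
    case 0
    then show ?case using D by simp
  next
    case (Suc t)
    note [measurable] = Suc
    obtain s a where "x = (s, a)" by (cases x)
    then show ?case
      by (simp add: pmf_bind expectation_pmf_finite case_prod_beta pair)
  qed
  show ?thesis
    unfolding discounted_return_def expectation_pmf_finite by measurable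
qed

lemma action_value_measurable:
  fixes T :: "'s::finite \<Rightarrow> 'a::finite \<Rightarrow> 's pmf"
  assumes "random_policy M \<mu>"
  shows "(\<lambda>\<omega>. action_value R T \<gamma> (\<mu> \<omega>) s a) \<in> borel_measurable M"
  unfolding action_value_def by (rule discounted_return_measurable[OF assms]) simp

text \<open>Monotonicity of the measure. Since \<open>measure\<close> is 0 on sets outside the
  sigma-algebra, the target event has to be shown measurable.\<close>

lemma at_prob_mono_AE:
  assumes "prob_space M" and "at_prob M p P"
    and "AE \<omega> in M. P \<omega> \<longrightarrow> Q \<omega>" and "{\<omega> \<in> space M. Q \<omega>} \<in> sets M"
  shows "at_prob M p Q"
proof -
  interpret prob_space M by fact
  have "measure M {\<omega> \<in> space M. P \<omega>} \<le> measure M {\<omega> \<in> space M. Q \<omega>}"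
    using assms(3,4) by (intro finite_measure_mono_AE) auto
  with assms(2) show ?thesis by (simp add: at_prob_def)
qed

context
  fixes R :: "'s::finite \<Rightarrow> 'a::finite \<Rightarrow> real"
    and T :: "'s \<Rightarrow> 'a \<Rightarrow> 's pmf"
    and \<gamma> :: real
  assumes reward: "\<And>s a. 0 \<le> R s a \<and> R s a \<le> 1"
    and discount: "0 \<le> \<gamma>" "\<gamma> < 1"
begin

lemma expected_reward_bounds:
  "0 \<le> measure_pmf.expectation D (\<lambda>(s, a). R s a)"
  "measure_pmf.expectation D (\<lambda>(s, a). R s a) \<le> 1"
  using reward by (auto intro!: expectation_pmf_ge_finite expectation_pmf_le_finite)

lemma discounted_return_sums:
  "(\<lambda>t. \<gamma> ^ t * measure_pmf.expectation (sa_law T \<mu> D t) (\<lambda>(s, a). R s a))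
    sums discounted_return R T \<gamma> \<mu> D"
  unfolding discounted_return_def
proof (rule summable_sums, rule summable_comparison_test')
  show "summable (\<lambda>t. \<gamma> ^ t)" using discount by (simp add: summable_geometric)
  show "norm (\<gamma> ^ t * measure_pmf.expectation (sa_law T \<mu> D t) (\<lambda>(s, a). R s a)) \<le> \<gamma> ^ t" for t
    using discount expected_reward_bounds[of "sa_law T \<mu> D t"]
    by (simp add: abs_mult mult_left_le)
qed

text \<open>A bound uniform in the policy, so that the supremum defining
  \<open>opt_action_value\<close> is a true upper bound.\<close>

lemma discounted_return_le: "discounted_return R T \<gamma> \<mu> D \<le> 1 / (1 - \<gamma>)"
proof (rule sums_le[OF _ discounted_return_sums])
  show "(\<lambda>t. \<gamma> ^ t) sums (1 / (1 - \<gamma>))" using discount by (simp add: geometric_sums)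
  show "\<gamma> ^ t * measure_pmf.expectation (sa_law T \<mu> D t) (\<lambda>(s, a). R s a) \<le> \<gamma> ^ t" for t
    using discount expected_reward_bounds[of "sa_law T \<mu> D t"] by (simp add: mult_left_le)
qed

text \<open>The return is affine in the initial law: each term of the series is, by
  \<open>sa_law_bind\<close>, and a finite mixture of convergent series may be summed
  termwise.\<close>

lemma discounted_return_bind:
  fixes D :: "'x::finite pmf"
  shows "discounted_return R T \<gamma> \<mu> (bind_pmf D f) =
    measure_pmf.expectation D (\<lambda>x. discounted_return R T \<gamma> \<mu> (f x))"
proof (rule sums_unique2[OF discounted_return_sums])
  let ?e = "\<lambda>D t. measure_pmf.expectation (sa_law T \<mu> D t) (\<lambda>(s, a). R s a)"
  have "(\<lambda>t. \<Sum>x\<in>UNIV. pmf D x * (\<gamma> ^ t * ?e (f x) t)) sums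
      (\<Sum>x\<in>UNIV. pmf D x * discounted_return R T \<gamma> \<mu> (f x))"
    by (intro sums_sum sums_mult discounted_return_sums)
  moreover have "\<gamma> ^ t * ?e (bind_pmf D f) t = (\<Sum>x\<in>UNIV. pmf D x * (\<gamma> ^ t * ?e (f x) t))" for t
    unfolding sa_law_bind expectation_bind_pmf_finite
    by (simp add: expectation_pmf_finite[of D] sum_distrib_left mult.left_commute)
  ultimately show "(\<lambda>t. \<gamma> ^ t * ?e (bind_pmf D f) t) sums
      measure_pmf.expectation D (\<lambda>x. discounted_return R T \<gamma> \<mu> (f x))"
    by (simp add: expectation_pmf_finite[of D])
qed

lemma state_value_eq_expectation_action_value:
  "state_value R T \<gamma> \<mu> s = measure_pmf.expectation (\<mu> s) (action_value R T \<gamma> \<mu> s)"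
  unfolding state_value_def action_value_def map_pmf_def discounted_return_bind ..

lemma action_value_Bellman:
  "action_value R T \<gamma> \<mu> s a =
    R s a + \<gamma> * measure_pmf.expectation (T s a) (state_value R T \<gamma> \<mu>)"
proof -
  let ?D = "bind_pmf (T s a) (\<lambda>s'. map_pmf (Pair s') (\<mu> s'))"
  let ?e = "\<lambda>D t. measure_pmf.expectation (sa_law T \<mu> D t) (\<lambda>(s, a). R s a)"
  have "(\<lambda>t. \<gamma> ^ Suc t * ?e (return_pmf (s, a)) (Suc t)) sums (\<gamma> * discounted_return R T \<gamma> \<mu> ?D)"
    using sums_mult[OF discounted_return_sums[of \<mu> ?D], of \<gamma>]
    by (simp add: sa_law_Suc_shift bind_return_pmf mult.assoc del: sa_law.simps(2))
  \<comment> \<open>Restores the term at index 0, which is the immediate reward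
    \<open>R s a\<close>.\<close>
  from sums_Suc[OF this]
  have "action_value R T \<gamma> \<mu> s a = R s a + \<gamma> * discounted_return R T \<gamma> \<mu> ?D"
    unfolding action_value_def
    using sums_unique2[OF discounted_return_sums] by (fastforce simp: add.commute)
  then show ?thesis
    by (simp add: discounted_return_bind state_value_def[abs_def])
qed

lemma action_value_le_opt: "action_value R T \<gamma> \<mu> s a \<le> opt_action_value R T \<gamma> s a"
  unfolding opt_action_value_def
proof (rule cSUP_upper)
  show "bdd_above (range (\<lambda>\<mu>. action_value R T \<gamma> \<mu> s a))"
    by (intro bdd_aboveI2[of _ _ "1 / (1 - \<gamma>)"]) (simp add: action_value_def discounted_return_le)
qed simp

text \<open>Randomizing over actions cannot beat the best one: every state value is an average of
  action values, each at most its optimum.\<close>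

lemma opt_state_value_le_Max: "opt_state_value R T \<gamma> s \<le> (MAX a. opt_action_value R T \<gamma> s a)"
  unfolding opt_state_value_def
proof (rule cSUP_least)
  fix \<mu> :: "('s, 'a) policy"
  have "action_value R T \<gamma> \<mu> s a \<le> (MAX a. opt_action_value R T \<gamma> s a)" for a
    using action_value_le_opt[of \<mu> s a] by (rule order_trans) simp
  then show "state_value R T \<gamma> \<mu> s \<le> (MAX a. opt_action_value R T \<gamma> s a)"
    unfolding state_value_eq_expectation_action_value by (intro expectation_pmf_le_finite)
qed simp

text \<open>By the Bellman equation the lookahead in \<open>greedy_policy\<close> is the policy's
  own action value, so every action in its support maximizes that value, and so does the
  average.\<close>

lemma action_value_le_state_value_greedy:
  assumes "greedy_policy R T \<gamma> (state_value R T \<gamma> \<mu>) \<mu>"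
  shows "action_value R T \<gamma> \<mu> s b \<le> state_value R T \<gamma> \<mu> s"
  unfolding state_value_eq_expectation_action_value[of \<mu> s]
  using assms unfolding greedy_policy_def action_value_Bellman[symmetric]
  by (intro expectation_pmf_ge_finite) blast

lemma opt_state_value_diff_less_greedy:
  assumes greedy: "greedy_policy R T \<gamma> (state_value R T \<gamma> \<mu>) \<mu>"
    and less: "\<And>a. opt_action_value R T \<gamma> s a - action_value R T \<gamma> \<mu> s a < e"
  shows "opt_state_value R T \<gamma> s - state_value R T \<gamma> \<mu> s < e"
proof -
  \<comment> \<open>The maximum is attained at some action; applying the strict hypothesis there
    keeps the conclusion strict.\<close>
  have "(MAX a. opt_action_value R T \<gamma> s a) \<in> range (opt_action_value R T \<gamma> s)"
    by (rule Max_in) auto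
  then obtain a where "(MAX a. opt_action_value R T \<gamma> s a) = opt_action_value R T \<gamma> s a"
    by (rule rangeE)
  then show ?thesis
    using opt_state_value_le_Max[of s] less[of a] action_value_le_state_value_greedy[OF greedy, of s a]
    by linarith
qed

lemma state_value_measurable:
  assumes "random_policy M \<mu>"
  shows "(\<lambda>\<omega>. state_value R T \<gamma> (\<mu> \<omega>) s) \<in> borel_measurable M"
proof -
  have [measurable]: "(\<lambda>\<omega>. pmf (\<mu> \<omega> s) a) \<in> borel_measurable M" for a
    using assms by (simp add: random_policy_def)
  note [measurable] = action_value_measurable[OF assms]
  show ?thesis
    unfolding state_value_eq_expectation_action_value expectation_pmf_finite by measurable
qed

end

theorem theorem1:
  fixes R :: "'s::finite \<Rightarrow> 'a::finite \<Rightarrow> real"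
    and T :: "'s \<Rightarrow> 'a \<Rightarrow> 's pmf"
    and \<gamma> \<delta> \<epsilon> \<epsilon>' :: real
    and M :: "'w measure"
    and \<pi> \<pi>' :: "'w \<Rightarrow> ('s, 'a) policy"
  assumes reward: "\<And>s a. 0 \<le> R s a \<and> R s a \<le> 1"
    and discount: "0 \<le> \<gamma>" "\<gamma> < 1"
    and prob: "prob_space M"
    and random: "random_policy M \<pi>" "random_policy M \<pi>'"
    and close: "AE \<omega> in M. \<forall>s a.
      \<bar>action_value R T \<gamma> (\<pi> \<omega>) s a - action_value R T \<gamma> (\<pi>' \<omega>) s a\<bar> \<le> \<epsilon>"
  shows
    "((\<forall>s a. at_prob M (1 - \<delta>)
          (\<lambda>\<omega>. opt_action_value R T \<gamma> s a - action_value R T \<gamma> (\<pi> \<omega>) s a < \<epsilon>'))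
      \<longrightarrow> (\<forall>s a. at_prob M (1 - \<delta>)
          (\<lambda>\<omega>. opt_action_value R T \<gamma> s a - action_value R T \<gamma> (\<pi>' \<omega>) s a \<le> \<epsilon> + \<epsilon>')))
     \<and>
     (at_prob M (1 - \<delta>)
          (\<lambda>\<omega>. \<forall>s a. opt_action_value R T \<gamma> s a - action_value R T \<gamma> (\<pi> \<omega>) s a < \<epsilon>')
      \<longrightarrow> at_prob M (1 - \<delta>)
            (\<lambda>\<omega>. \<forall>s a. opt_action_value R T \<gamma> s a - action_value R T \<gamma> (\<pi>' \<omega>) s a \<le> \<epsilon> + \<epsilon>')
          \<and> eps_optimal_Q R T \<gamma> M \<delta> (\<epsilon> + \<epsilon>') \<pi>'
          \<and> ((AE \<omega> in M. greedy_policy R T \<gamma> (state_value R T \<gamma> (\<pi>' \<omega>)) (\<pi>' \<omega>))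
              \<longrightarrow> eps_optimal_V R T \<gamma> M \<delta> (\<epsilon> + \<epsilon>') \<pi>'))"
proof (intro conjI impI allI)
  \<comment> \<open>These rules let each closing \<open>measurable\<close> show that the target
    event about \<open>\<pi>'\<close> is measurable.\<close>
  note [measurable] = action_value_measurable[OF random(2)]
    state_value_measurable[OF reward discount random(2)]
  let ?Q = "action_value R T \<gamma>" and ?Qopt = "opt_action_value R T \<gamma>"
  {
    fix s a
    assume "\<forall>s a. at_prob M (1 - \<delta>) (\<lambda>\<omega>. ?Qopt s a - ?Q (\<pi> \<omega>) s a < \<epsilon>')"
    then have "at_prob M (1 - \<delta>) (\<lambda>\<omega>. ?Qopt s a - ?Q (\<pi> \<omega>) s a < \<epsilon>')" by blast
    then show "at_prob M (1 - \<delta>) (\<lambda>\<omega>. ?Qopt s a - ?Q (\<pi>' \<omega>) s a \<le> \<epsilon> + \<epsilon>')"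
    proof (rule at_prob_mono_AE[OF prob])
      show "AE \<omega> in M. ?Qopt s a - ?Q (\<pi> \<omega>) s a < \<epsilon>' \<longrightarrow> ?Qopt s a - ?Q (\<pi>' \<omega>) s a \<le> \<epsilon> + \<epsilon>'"
        using close by eventually_elim (smt (verit))
    qed measurable
  }
  assume *: "at_prob M (1 - \<delta>) (\<lambda>\<omega>. \<forall>s a. ?Qopt s a - ?Q (\<pi> \<omega>) s a < \<epsilon>')"
  \<comment> \<open>Adding a gap below \<open>\<epsilon>'\<close> to one of at most
    \<open>\<epsilon>\<close> stays strict. This one implication serves the non-strict bound and
    both notions of optimality.\<close>
  have less: "AE \<omega> in M. (\<forall>s a. ?Qopt s a - ?Q (\<pi> \<omega>) s a < \<epsilon>') \<longrightarrow>
      (\<forall>s a. ?Qopt s a - ?Q (\<pi>' \<omega>) s a < \<epsilon> + \<epsilon>')"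
    using close by eventually_elim (smt (verit))
  show "at_prob M (1 - \<delta>) (\<lambda>\<omega>. \<forall>s a. ?Qopt s a - ?Q (\<pi>' \<omega>) s a \<le> \<epsilon> + \<epsilon>')"
  proof (rule at_prob_mono_AE[OF prob *])
    show "AE \<omega> in M. (\<forall>s a. ?Qopt s a - ?Q (\<pi> \<omega>) s a < \<epsilon>') \<longrightarrow>
        (\<forall>s a. ?Qopt s a - ?Q (\<pi>' \<omega>) s a \<le> \<epsilon> + \<epsilon>')"
      using less by eventually_elim (blast intro: less_imp_le)
  qed measurable
  show "eps_optimal_Q R T \<gamma> M \<delta> (\<epsilon> + \<epsilon>') \<pi>'"
    unfolding eps_optimal_Q_def
    by (rule at_prob_mono_AE[OF prob * less]) measurable
  assume greedy: "AE \<omega> in M. greedy_policy R T \<gamma> (state_value R T \<gamma> (\<pi>' \<omega>)) (\<pi>' \<omega>)"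
  show "eps_optimal_V R T \<gamma> M \<delta> (\<epsilon> + \<epsilon>') \<pi>'"
    unfolding eps_optimal_V_def
  proof (rule at_prob_mono_AE[OF prob *])
    show "AE \<omega> in M. (\<forall>s a. ?Qopt s a - ?Q (\<pi> \<omega>) s a < \<epsilon>') \<longrightarrow>
        (\<forall>s. opt_state_value R T \<gamma> s - state_value R T \<gamma> (\<pi>' \<omega>) s < \<epsilon> + \<epsilon>')"
      \<comment> \<open>Greediness holds almost surely, so intersecting with it costs no probability
        and \<open>\<delta>\<close> is unchanged.\<close>
      using less greedy
      by eventually_elim (intro impI allI opt_state_value_diff_less_greedy[OF reward discount], auto)
  qed measurable
qed

end
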